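(* There is a two-dimensional continued fraction expansion $\mu^*$ and a dense subset $\mathcal D$ of $\mathbb R^2$ consisting of rank 3 points such that for every $x=(\alpha,\beta)\in\mathcal D$, all angles of every triangle of the sequence $\mu^*(x)=E^*_0,E^*_1,\dots$ are $>\arcsin(23^{1/2}/6)$. Thus, $$\lim_{n\to\infty}\frac{\max_{i=1,2,3}\operatorname{dist}(x,v^*_{ni})}{(2d^*_{n1}d^*_{n2}d^*_{n3})^{-1/2}}\ \leq\ \lim_{n\to\infty}\frac{\operatorname{diam}(E^*_n)}{\operatorname{area}(E^*_n)^{1/2}}\ <\ 2\cdot\left(\frac{13}{23}\right)^{1/4},$$ where $v^*_{ni}=(p^*_{ni}/d^*_{ni},q^*_{ni}/d^*_{ni})$ denotes the $i$th vertex of the triangle $E^*_n$ ($i=1,2,3$).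
   Context: A two-dimensional continued fraction expansion is a map $\mu$ assigning to every $x\in\mathbb R^2\setminus\mathbb Q^2$ a sequence $\mu(x)=T_0,T_1,\dots$ of triangles $T_n\subseteq\mathbb R^2$ with rational vertices $(p_{ni}/d_{ni},q_{ni}/d_{ni})$, where $p_{ni},q_{ni},d_{ni}\in\mathbb Z$, $d_{ni}>0$, $i=1,2,3$, such that $\bigcap_n T_n=\{x\}$ and, for every $n$, the $3\times3$ integer matrix with rows $(p_{ni},q_{ni},d_{ni})$, $i=1,2,3$, has determinant $\pm1$. (For $\mu^*$ the integers $p^*_{ni},q^*_{ni},d^*_{ni}$ play the role of $p_{ni},q_{ni},d_{ni}$.) A point $x=(x_1,x_2)\in\mathbb R^2$ is a rank 3 point if the subgroup $\mathbb Zx_1+\mathbb Zx_2+\mathbb Z$ of the additive group $\mathbb R$ has rank 3 (equivalently, $x_1,x_2,1$ are linearly independent over $\mathbb Q$). For a triangle $T$, $\operatorname{diam}(T)$ is the length of its longest side; $\operatorname{dist}$ is euclidean distance. *)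

theory Defs
  imports "HOL-Analysis.Analysis"
begin

text \<open>
  A triangle with rational vertices is given by an integer \<open>3 \<times> 3\<close> matrix whose \<open>i\<close>th row
  \<open>(p, q, d)\<close> holds homogeneous coordinates of the \<open>i\<close>th vertex \<open>(p/d, q/d)\<close>.
  If the determinant is \<open>\<plusminus>1\<close> and all \<open>d > 0\<close>, each row is primitive, so the matrix is
  the same datum as the triangle together with a numbering of its vertices.
\<close>

definition denom :: "int^3^3 \<Rightarrow> 3 \<Rightarrow> int" where
  "denom T i = T $ i $ 3"

definition vertex :: "int^3^3 \<Rightarrow> 3 \<Rightarrow> real^2" where
  "vertex T i = vector [real_of_int (T $ i $ 1) / real_of_int (denom T i),
                        real_of_int (T $ i $ 2) / real_of_int (denom T i)]"

definition triangle :: "int^3^3 \<Rightarrow> (real^2) set" where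
  "triangle T = convex hull (range (vertex T))"

definition unimodular :: "int^3^3 \<Rightarrow> bool" where
  "unimodular T \<longleftrightarrow> (\<forall>i. denom T i > 0) \<and> (det T = 1 \<or> det T = - 1)"

definition rational_points :: "(real^2) set" where
  "rational_points = {x. x $ 1 \<in> \<rat> \<and> x $ 2 \<in> \<rat>}"

text \<open>The values of \<open>\<mu>\<close> at rational points are irrelevant.\<close>

definition continued_fraction_expansion :: "(real^2 \<Rightarrow> nat \<Rightarrow> int^3^3) \<Rightarrow> bool" where
  "continued_fraction_expansion \<mu> \<longleftrightarrow>
     (\<forall>x. x \<notin> rational_points \<longrightarrow>
        (\<forall>n. unimodular (\<mu> x n)) \<and> (\<Inter>n. triangle (\<mu> x n)) = {x})"

text \<open>The real numbers as a \<open>\<int>\<close>-module; its submodules are the additive subgroups.\<close>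

global_interpretation int_real: module "\<lambda>(k::int) (x::real). of_int k * x"
  by unfold_locales (auto simp: algebra_simps)

text \<open>The rank of a group is the maximal size of a \<open>\<int>\<close>-linearly independent subset.\<close>

definition has_rank :: "real set \<Rightarrow> nat \<Rightarrow> bool" where
  "has_rank G r \<longleftrightarrow>
     (\<exists>B\<subseteq>G. finite B \<and> card B = r \<and> int_real.independent B) \<and>
     (\<forall>B\<subseteq>G. int_real.independent B \<longrightarrow> finite B \<and> card B \<le> r)"

definition rank3_point :: "real^2 \<Rightarrow> bool" where
  "rank3_point x \<longleftrightarrow> has_rank (int_real.span {x $ 1, x $ 2, 1}) 3"

text \<open>The angle at \<open>b\<close> between the segments \<open>ba\<close> and \<open>bc\<close>.\<close>

definition angle :: "real^2 \<Rightarrow> real^2 \<Rightarrow> real^2 \<Rightarrow> real" where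
  "angle a b c = arccos (((a - b) \<bullet> (c - b)) / (norm (a - b) * norm (c - b)))"

definition longest_side :: "int^3^3 \<Rightarrow> real" where
  "longest_side T = Max {dist (vertex T i) (vertex T j) | i j. i \<noteq> j}"

definition area :: "int^3^3 \<Rightarrow> real" where
  "area T = measure lebesgue (triangle T)"

end

theory Submission imports Defs begin

text \<open>
  A rational triangle of determinant \<open>\<plusminus>m\<close> with \<open>m > 1\<close> is subdivided by the image of a lattice
  point in the fundamental parallelepiped of its rows; the pieces have smaller determinant, so every
  point lies in arbitrarily small unimodular triangles.

  Near-equilateral unimodular triangles occur in every disc: if \<open>r, s, t\<close> are the rows of a
  unimodular triangle there, put \<open>u = m r + s\<close>. Then \<open>u\<close>, \<open>r + u\<close>, \<open>t + k r + b u\<close> is again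
  unimodular for all integers \<open>k\<close>, \<open>b\<close>. As \<open>m\<close> grows, the sides issuing from \<open>u\<close> shrink like the
  inverse square of the denominator \<open>D\<close> of \<open>u\<close>; choosing \<open>k / D\<close> close to a suitable constant
  adjusts the angle at \<open>u\<close>, and choosing \<open>b / D\<close> close to another one adjusts the ratio of the
  two sides. So the rescaled triangles converge to an equilateral one.

  By Baire, the points lying inside arbitrarily small near-equilateral unimodular triangles and on no
  rational line are dense. Passing to a subsequence makes both quotients converge.
\<close>

section \<open>Unimodular refinement of rational triangles\<close>

definition real_row :: "int^3 \<Rightarrow> real^3" where
  "real_row r = (\<chi> j. of_int (r $ j))"

definition homogenize :: "real^2 \<Rightarrow> real^3" where
  "homogenize x = vector [x $ 1, x $ 2, 1]"

definition real_matrix :: "int^3^3 \<Rightarrow> real^3^3" where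
  "real_matrix T = (\<chi> i. real_row (T $ i))"

lemma det_real_matrix: "det (real_matrix T) = of_int (det T)"
  by (simp add: det_3 real_matrix_def real_row_def)

lemma range_3: "range f = {f (1::3), f 2, f 3}"
  by (auto simp: UNIV_3)

lemma triangle_eq: "triangle T = convex hull {vertex T 1, vertex T 2, vertex T 3}"
  by (simp add: triangle_def range_3)

lemma vertex_nth [simp]:
  "vertex T i $ 1 = of_int (T $ i $ 1) / of_int (T $ i $ 3)"
  "vertex T i $ 2 = of_int (T $ i $ 2) / of_int (T $ i $ 3)"
  by (simp_all add: vertex_def denom_def)

lemma homogenize_vertex:
  assumes "denom T i > 0"
  shows "real_row (T $ i) = of_int (denom T i) *\<^sub>R homogenize (vertex T i)"
  using assms by (simp add: vec_eq_iff forall_3 real_row_def homogenize_def denom_def)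

lemma vec_eq_homogenize_iff:
  "v = homogenize x \<longleftrightarrow> v $ 1 = x $ 1 \<and> v $ 2 = x $ 2 \<and> v $ 3 = 1"
  by (simp add: vec_eq_iff forall_3 homogenize_def)

text \<open>In homogeneous coordinates a convex combination of vertices becomes a nonnegative
  combination of rows: the weight of vertex i is \<open>c i\<close> times its denominator, and the
  third coordinate forces the weights to sum to 1. This form is linear in the rows, which suits the
  later replacement of one row by another.\<close>

lemma mem_triangle_iff:
  assumes "\<forall>i. denom T i > 0"
  shows "x \<in> triangle T \<longleftrightarrow>
    (\<exists>c. (\<forall>i. 0 \<le> c i) \<and> (\<Sum>i\<in>UNIV. c i *\<^sub>R real_row (T $ i)) = homogenize x)"
proof
  assume "x \<in> triangle T"
  then obtain u v w where *: "0 \<le> u" "0 \<le> v" "0 \<le> w" "u + v + w = 1"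
      "x = u *\<^sub>R vertex T 1 + v *\<^sub>R vertex T 2 + w *\<^sub>R vertex T 3"
    unfolding triangle_eq convex_hull_3 by auto
  define c where "c = (\<lambda>i::3. (if i = 1 then u else if i = 2 then v else w) / of_int (denom T i))"
  have "0 \<le> c i" for i
    using * assms[rule_format, of i] by (simp add: c_def)
  moreover have "c i *\<^sub>R real_row (T $ i)
      = (if i = 1 then u else if i = 2 then v else w) *\<^sub>R homogenize (vertex T i)" for i
    using assms[rule_format, of i] by (simp add: c_def homogenize_vertex)
  then have "(\<Sum>i\<in>UNIV. c i *\<^sub>R real_row (T $ i)) = homogenize x"
    using * by (simp add: sum_3 vec_eq_homogenize_iff) (simp add: homogenize_def)
  ultimately show "\<exists>c. (\<forall>i. 0 \<le> c i) \<and> (\<Sum>i\<in>UNIV. c i *\<^sub>R real_row (T $ i)) = homogenize x"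
    by blast
next
  assume "\<exists>c. (\<forall>i. 0 \<le> c i) \<and> (\<Sum>i\<in>UNIV. c i *\<^sub>R real_row (T $ i)) = homogenize x"
  then obtain c where c: "\<And>i. 0 \<le> c i"
      "(\<Sum>i\<in>UNIV. c i *\<^sub>R real_row (T $ i)) = homogenize x" by blast
  let ?u = "\<lambda>i. c i * of_int (denom T i)"
  have u0: "0 \<le> ?u i" for i
    using c(1)[of i] assms[rule_format, of i] by simp
  have "homogenize x = (\<Sum>i\<in>UNIV. ?u i *\<^sub>R homogenize (vertex T i))"
    using c(2) assms by (simp add: homogenize_vertex)
  then have eq: "homogenize x = ?u 1 *\<^sub>R homogenize (vertex T 1)
      + ?u 2 *\<^sub>R homogenize (vertex T 2) + ?u 3 *\<^sub>R homogenize (vertex T 3)"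
    by (simp only: sum_3)
  have "?u 1 + ?u 2 + ?u 3 = 1"
    using arg_cong[OF eq, of "\<lambda>v. v $ 3"] by (simp add: homogenize_def)
  moreover have "x = ?u 1 *\<^sub>R vertex T 1 + ?u 2 *\<^sub>R vertex T 2 + ?u 3 *\<^sub>R vertex T 3"
    using arg_cong[OF eq, of "\<lambda>v. v $ 1"] arg_cong[OF eq, of "\<lambda>v. v $ 2"]
    by (simp add: homogenize_def vec_eq_iff forall_2)
  ultimately show "x \<in> triangle T"
    unfolding triangle_eq convex_hull_3 using u0 by blast
qed

text \<open>The left side is the expansion \<open>det_3\<close> for the rows (a1 d, a2 d, d), (b1 e,
  b2 e, e), (c1 f, c2 f, f); the right side is the cross product form that occurs in the area of a
  triangle.\<close>

lemma det_3_dehomogenized: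
  fixes a1 a2 b1 b2 c1 c2 d e f :: real
  shows "(a1*d)*(b2*e)*f + (a2*d)*e*(c1*f) + d*(b1*e)*(c2*f)
    - (a1*d)*e*(c2*f) - (a2*d)*(b1*e)*f - d*(b2*e)*(c1*f)
   = - ((c1 - a1) * (b2 - a2) - (b1 - a1) * (c2 - a2)) * (d*e*f)"
  by algebra

lemma det_eq_vertices:
  assumes "\<forall>i. denom T i > 0"
  shows "real_of_int (det T) =
    - ((vertex T 3 $ 1 - vertex T 1 $ 1) * (vertex T 2 $ 2 - vertex T 1 $ 2)
        - (vertex T 2 $ 1 - vertex T 1 $ 1) * (vertex T 3 $ 2 - vertex T 1 $ 2))
      * (denom T 1 * denom T 2 * denom T 3)"
proof -
  have "real_of_int (T $ i $ 1) = vertex T i $ 1 * of_int (T $ i $ 3)"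
    "real_of_int (T $ i $ 2) = vertex T i $ 2 * of_int (T $ i $ 3)" for i
    using assms[rule_format, of i] by (simp_all add: denom_def)
  then show ?thesis
    by (simp only: det_3 of_int_add of_int_diff of_int_mult det_3_dehomogenized denom_def)
qed

text \<open>For determinant 1 or -1 this identifies 1 / (2 d1 d2 d3) with the area, so the two
  quotients of the theorem have the same denominator.\<close>

lemma area_eq:
  assumes "\<forall>i. denom T i > 0"
  shows "area T = \<bar>of_int (det T)\<bar> / (2 * of_int (denom T 1) * of_int (denom T 2) * of_int (denom T 3))"
proof -
  let ?a = "vertex T 1" and ?b = "vertex T 2" and ?c = "vertex T 3"
  have pos: "real_of_int (T $ 1 $ 3) > 0" "real_of_int (T $ 2 $ 3) > 0" "real_of_int (T $ 3 $ 3) > 0"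
    using assms by (auto simp: denom_def)
  have "closed (triangle T)"
    by (simp add: triangle_eq compact_imp_closed compact_convex_hull)
  then have "area T = measure lborel (triangle T)"
    unfolding area_def by (simp add: measure_completion borel_closed)
  also have "\<dots> = \<bar>(?c $ 1 - ?a $ 1) * (?b $ 2 - ?a $ 2) - (?b $ 1 - ?a $ 1) * (?c $ 2 - ?a $ 2)\<bar> / 2"
    by (simp only: triangle_eq content_triangle)
  also have "(?c $ 1 - ?a $ 1) * (?b $ 2 - ?a $ 2) - (?b $ 1 - ?a $ 1) * (?c $ 2 - ?a $ 2)
      = - of_int (det T) / (of_int (denom T 1) * of_int (denom T 2) * of_int (denom T 3))"
    using pos by (simp add: det_eq_vertices[OF assms] denom_def del: vertex_nth)
  finally show ?thesis
    using pos by (simp add: denom_def abs_mult)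
qed

text \<open>An inverse of the matrix with integer entries only would have an integer determinant
  inverse to \<open>det T\<close>, so some entry of the inverse is not an integer. Its row k writes
  the k-th unit vector in terms of the rows of \<open>T\<close>; passing to fractional parts
  subtracts an integer combination of rows, so the result is again an integer vector.\<close>

lemma refinement_vector:
  assumes "det T \<noteq> 0" "\<bar>det T\<bar> \<noteq> 1"
  obtains a :: "3 \<Rightarrow> real" and v :: "int^3"
  where "\<And>i. 0 \<le> a i" "\<And>i. a i < 1" "\<exists>i. a i > 0"
    "(\<Sum>i\<in>UNIV. a i *\<^sub>R real_row (T $ i)) = real_row v"
proof -
  have "det (real_matrix T) \<noteq> 0"
    using assms(1) by (simp add: det_real_matrix)
  then obtain B where B: "B ** real_matrix T = mat 1"
    using invertible_det_nz[of "real_matrix T"] invertible_left_inverse[of "real_matrix T"] by blast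
  have "\<exists>k i. B $ k $ i \<notin> \<int>"
  proof (rule ccontr)
    assume "\<not> ?thesis"
    then have "B $ k $ i \<in> \<int>" for k i by blast
    then have *: "of_int \<lfloor>B $ k $ i\<rfloor> = B $ k $ i" for k i
      by (metis Ints_cases floor_of_int)
    define C :: "int^3^3" where "C = (\<chi> k i. \<lfloor>B $ k $ i\<rfloor>)"
    have "B = real_matrix C"
      using * by (simp only: vec_eq_iff C_def real_matrix_def real_row_def vec_lambda_beta) simp
    then have "det (real_matrix C) * det (real_matrix T) = 1"
      using B by (metis det_mul det_I)
    then have "real_of_int (det C * det T) = 1"
      by (simp add: det_real_matrix)
    then have "det C * det T = 1" by linarith
    then show False
      using assms(2) abs_zmult_eq_1[of "det T" "det C"] by (simp add: mult.commute)
  qed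
  then obtain k i where ki: "B $ k $ i \<notin> \<int>" by blast
  define a where "a = (\<lambda>j. frac (B $ k $ j))"
  define v :: "int^3" where "v = axis k 1 - (\<Sum>j\<in>UNIV. \<lfloor>B $ k $ j\<rfloor> *s (T $ j))"
  have e: "(\<Sum>j\<in>UNIV. B $ k $ j * of_int (T $ j $ l)) = (if k = l then 1 else 0)" for l
  proof -
    have "(B ** real_matrix T) $ k $ l = (mat 1 :: real^3^3) $ k $ l" by (simp add: B)
    then show ?thesis
      by (simp add: matrix_matrix_mult_def real_matrix_def real_row_def mat_def)
  qed
  have "(\<Sum>j\<in>UNIV. a j *\<^sub>R real_row (T $ j)) = real_row v"
  proof (subst vec_eq_iff, rule allI)
    fix l
    have "(\<Sum>j\<in>UNIV. a j * of_int (T $ j $ l)) = (\<Sum>j\<in>UNIV. B $ k $ j * of_int (T $ j $ l))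
        - (\<Sum>j\<in>UNIV. of_int \<lfloor>B $ k $ j\<rfloor> * of_int (T $ j $ l))"
      by (simp add: a_def frac_def algebra_simps sum_subtractf)
    also have "\<dots> = of_int (v $ l)"
      by (simp add: e v_def axis_def eq_commute)
    finally show "(\<Sum>j\<in>UNIV. a j *\<^sub>R real_row (T $ j)) $ l = real_row v $ l"
      by (simp add: real_row_def)
  qed
  moreover have "a i > 0" using ki by (simp add: a_def)
  ultimately show ?thesis
    using that[of a v] by (auto simp: a_def frac_lt_1)
qed

text \<open>Induction on the absolute value of the determinant: replacing row i by the vector
  \<open>v\<close> of \<open>refinement_vector\<close> multiplies it by \<open>a i\<close> < 1. The
  index i is chosen so that x stays in the triangle.\<close>

lemma unimodular_refinement:
  assumes "\<forall>i. denom T i > 0" "det T \<noteq> 0" "x \<in> triangle T"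
  shows "\<exists>T'. unimodular T' \<and> x \<in> triangle T' \<and> triangle T' \<subseteq> triangle T"
  using assms
proof (induction "nat \<bar>det T\<bar>" arbitrary: T rule: less_induct)
  case less
  show ?case
  proof (cases "\<bar>det T\<bar> = 1")
    case True
    then have "unimodular T" using less.prems(1) by (auto simp: unimodular_def)
    then show ?thesis using less.prems(3) by blast
  next
    case False
    then obtain a :: "3 \<Rightarrow> real" and v where a: "\<And>i. 0 \<le> a i" "\<And>i. a i < 1" "\<exists>i. a i > 0"
        and v: "(\<Sum>i\<in>UNIV. a i *\<^sub>R real_row (T $ i)) = real_row v"
      using refinement_vector[OF less.prems(2)] by metis
    obtain c where c: "\<And>i. 0 \<le> c i" "(\<Sum>i\<in>UNIV. c i *\<^sub>R real_row (T $ i)) = homogenize x"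
      using less.prems(1,3) mem_triangle_iff by blast
    \<comment> \<open>The piece containing \<open>x\<close> replaces the row at which \<open>c i / a i\<close> is minimal.\<close>
    have "\<exists>i. is_arg_min (\<lambda>i. c i / a i) (\<lambda>i. i \<in> {i. a i > 0}) i"
      using a(3) by (intro ex_is_arg_min_if_finite) auto
    then obtain i where i: "a i > 0" "\<And>j. a j > 0 \<Longrightarrow> c i / a i \<le> c j / a j"
      by (auto simp: is_arg_min_linorder)
    define S where "S = (\<chi> j. if j = i then v else T $ j)"
    have S: "real_row (S $ j) = (if j = i then real_row v else real_row (T $ j))" for j
      by (simp add: S_def)
    \<comment> \<open>Expanding \<open>v\<close> turns coefficients for the rows of \<open>S\<close>
      into coefficients for the rows of \<open>T\<close>. This serves both the membership of x in
      \<open>triangle S\<close> and the inclusion of \<open>triangle S\<close> in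
      \<open>triangle T\<close>.\<close>
    have swap: "(\<Sum>j\<in>UNIV. f j *\<^sub>R real_row (S $ j))
        = (\<Sum>j\<in>UNIV. ((if j = i then 0 else f j) + f i * a j) *\<^sub>R real_row (T $ j))" for f
    proof -
      have "(\<Sum>j\<in>UNIV. f j *\<^sub>R real_row (S $ j))
          = (\<Sum>j\<in>UNIV. (if j = i then 0 else f j) *\<^sub>R real_row (T $ j)
              + (if j = i then f i *\<^sub>R real_row v else 0))"
        by (rule sum.cong) (auto simp: S)
      also have "\<dots> = (\<Sum>j\<in>UNIV. (if j = i then 0 else f j) *\<^sub>R real_row (T $ j))
          + f i *\<^sub>R (\<Sum>j\<in>UNIV. a j *\<^sub>R real_row (T $ j))"
        by (simp add: sum.distrib v)
      finally show ?thesis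
        by (simp add: scaleR_sum_right sum.distrib scaleR_add_left)
    qed
    have denS: "\<forall>j. denom S j > 0"
    proof
      fix j
      have "real_row v $ 3 = (\<Sum>j\<in>UNIV. a j * of_int (denom T j))"
        unfolding v[symmetric] by (simp add: real_row_def denom_def)
      also have "\<dots> > 0"
        using a(1) i(1) less.prems(1) by (intro sum_pos2[of _ i]) (auto simp: less_imp_le)
      finally have "v $ 3 > 0" by (simp add: real_row_def)
      then show "denom S j > 0"
        using less.prems(1) by (simp add: S_def denom_def)
    qed
    \<comment> \<open>The shape of Cramer's rule: row i is replaced by the combination of all rows
      with coefficients \<open>a\<close>, which scales the determinant by
      \<open>a i\<close>.\<close>
    have "real_matrix S = (\<chi> j. if j = i then \<Sum>l\<in>UNIV. ((\<chi> j. a j) $ l) *s row l (real_matrix T)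
        else row j (real_matrix T))"
      unfolding real_matrix_def row_def S
      by (intro arg_cong[of _ _ vec_lambda] ext) (simp add: v scalar_mult_eq_scaleR)
    then have "det (real_matrix S) = a i * det (real_matrix T)"
      using cramer_lemma_transpose[of i "\<chi> j. a j" "real_matrix T"] by simp
    then have det: "of_int (det S) = a i * of_int (det T)"
      by (simp add: det_real_matrix)
    have "\<bar>real_of_int (det S)\<bar> < \<bar>real_of_int (det T)\<bar>"
      using a(1)[of i] a(2)[of i] less.prems(2) by (simp add: det abs_mult)
    then have "nat \<bar>det S\<bar> < nat \<bar>det T\<bar>" by linarith
    moreover have "det S \<noteq> 0"
      using det i(1) less.prems(2) by (metis mult_eq_0_iff of_int_eq_0_iff less_irrefl)
    moreover have "x \<in> triangle S"
    proof -
      \<comment> \<open>Coefficients of x for the rows of \<open>S\<close>: take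
        \<open>c i / a i\<close> copies of \<open>v\<close> and deduct its share from the other
        rows. Minimality of the quotient keeps the remainders nonnegative.\<close>
      define f where "f = (\<lambda>j. if j = i then c i / a i else c j - c i / a i * a j)"
      have "0 \<le> f j" for j
      proof (cases "a j > 0")
        case True
        then show ?thesis using i(2)[OF True] c(1) i(1) by (auto simp: f_def field_simps)
      next
        case False
        then have "a j = 0" using a(1)[of j] by simp
        then show ?thesis using c(1) i(1) by (auto simp: f_def)
      qed
      moreover have "(if j = i then 0 else f j) + f i * a j = c j" for j
        using i(1) by (simp add: f_def)
      ultimately show ?thesis
        using c(2) by (subst mem_triangle_iff[OF denS]) (auto simp: swap intro!: exI[of _ f])
    qed
    moreover have "triangle S \<subseteq> triangle T"
    proof
      fix y assume "y \<in> triangle S"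
      then obtain f where f: "\<And>j. 0 \<le> f j" "(\<Sum>j\<in>UNIV. f j *\<^sub>R real_row (S $ j)) = homogenize y"
        using mem_triangle_iff[OF denS] by blast
      then show "y \<in> triangle T"
        using a(1)
        by (subst mem_triangle_iff[OF less.prems(1)])
          (auto simp: swap intro!: exI[of _ "\<lambda>j. (if j = i then 0 else f j) + f i * a j"])
    qed
    ultimately show ?thesis
      using less.hyps[of S] denS by blast
  qed
qed

lemma unimodular_triangle_in_ball:
  assumes "e > 0"
  obtains T where "unimodular T" "x \<in> triangle T" "triangle T \<subseteq> ball x e"
proof -
  \<comment> \<open>Each vertex of the grid triangle below differs from x by at most 2/Q in each
    coordinate, hence by at most 4/Q < e in norm.\<close>
  obtain Q0 :: nat where Q0: "real Q0 > 8 / e" using reals_Archimedean2 by blast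
  define Q where "Q = int Q0"
  have Qe: "real_of_int Q * e > 8" "Q > 0"
proof -
    have "8 / e > 0" using assms by simp
    then have "real Q0 > 0" using Q0 by linarith
    then show "real_of_int Q * e > 8" "Q > 0"
      using Q0 assms by (simp_all add: Q_def pos_divide_less_eq)
  qed
  define a b where "a = \<lfloor>Q * x $ 1\<rfloor>" "b = \<lfloor>Q * x $ 2\<rfloor>"
  \<comment> \<open>A right triangle with legs 2/Q contains the whole grid cell of mesh 1/Q at its
    right angle, and x lies in that cell. Its determinant 4Q is nonzero, so it can be
    refined.\<close>
  define T :: "int^3^3" where "T = vector [vector [a, b, Q], vector [a + 2, b, Q], vector [a, b + 2, Q]]"
  have den: "\<forall>i. denom T i > 0"
    using Qe by (simp add: forall_3 T_def denom_def)
  have "det T = 4 * Q"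
    by (simp add: det_3 T_def algebra_simps)
  then have "det T \<noteq> 0" using Qe by simp
  define s t where "s = Q * x $ 1 - a" "t = Q * x $ 2 - b"
  have st: "0 \<le> s" "s < 1" "0 \<le> t" "t < 1"
    unfolding s_t_def a_b_def by linarith+
  have Qx: "x $ 1 = (a + s) / Q" "x $ 2 = (b + t) / Q"
    using Qe by (auto simp: s_t_def)
  have "x \<in> triangle T"
  proof (subst mem_triangle_iff[OF den], intro exI conjI)
    let ?c = "\<lambda>i::3. (if i = 1 then 1 - s / 2 - t / 2 else if i = 2 then s / 2 else t / 2) / Q"
    show "\<forall>i. 0 \<le> ?c i" using st Qe by (simp add: forall_3)
    have *: "(1 - s / 2 - t / 2) / q * a + s / 2 / q * (a + 2) + t / 2 / q * a = (a + s) / q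
        \<and> (1 - s / 2 - t / 2) / q * b + s / 2 / q * b + t / 2 / q * (b + 2) = (b + t) / q
        \<and> (1 - s / 2 - t / 2) / q * q + s / 2 / q * q + t / 2 / q * q = 1"
      if "q \<noteq> 0" for a b q :: real
      using that by (simp add: divide_simps) (simp add: algebra_simps)
    show "(\<Sum>i\<in>UNIV. ?c i *\<^sub>R real_row (T $ i)) = homogenize x"
      using *[of Q a b] Qe(2) by (simp add: sum_3 vec_eq_homogenize_iff real_row_def T_def Qx)
  qed
  then obtain T' where T': "unimodular T'" "x \<in> triangle T'" "triangle T' \<subseteq> triangle T"
    using unimodular_refinement[OF den \<open>det T \<noteq> 0\<close>] by blast
  have "vertex T i \<in> ball x e" for i
  proof -
    have *: "\<bar>vertex T i $ j - x $ j\<bar> \<le> 2 / Q" for j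
    proof -
      have "vertex T i $ j - x $ j \<in> {- s / Q, (2 - s) / Q, - t / Q, (2 - t) / Q}"
        using exhaust_3[of i] exhaust_2[of j]
        by (auto simp: T_def Qx diff_divide_distrib add_divide_distrib)
      then obtain z where z: "z \<in> {- s, 2 - s, - t, 2 - t}" "vertex T i $ j - x $ j = z / Q"
        by blast
      from z(1) have "\<bar>z\<bar> \<le> 2" using st by auto
      then show ?thesis using Qe(2) z(2) by (simp add: abs_divide divide_right_mono)
    qed
    have "norm (vertex T i - x) \<le> (\<Sum>j\<in>UNIV. \<bar>(vertex T i - x) $ j\<bar>)"
      by (rule norm_le_l1_cart)
    also have "\<dots> \<le> 4 / Q"
      using *[of 1] *[of 2] by (simp add: sum_2)
    also have "\<dots> < e" using Qe by (simp add: field_simps)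
    finally show ?thesis by (simp add: dist_norm norm_minus_commute)
  qed
  then have "triangle T \<subseteq> ball x e"
    unfolding triangle_def by (intro hull_minimal) auto
  then show ?thesis using that T' by blast
qed

section \<open>Near-equilateral unimodular triangles\<close>

text \<open>With h the component of q orthogonal to p, the vector g = p/2 + mu h is p turned by 60
  degrees towards q once mu h has squared length 3/4 of that of p. Adding a multiple of p to q
  adjusts the direction to that of g, and the factor \<open>\<beta>\<close> records the remaining
  change of length.\<close>

lemma equilateral_completion:
  fixes p q :: "'a::real_inner"
  assumes "p \<noteq> 0" "\<And>c. q \<noteq> c *\<^sub>R p"
  obtains \<kappa> \<beta> g where "\<beta> > 0" "q + \<kappa> *\<^sub>R p = \<beta> *\<^sub>R g" "g \<bullet> g = p \<bullet> p" "g \<bullet> p = p \<bullet> p / 2"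
proof -
  define c where "c = (q \<bullet> p) / (p \<bullet> p)"
  define h where "h = q - c *\<^sub>R p"
  have pp: "p \<bullet> p > 0" using assms(1) by simp
  have "h \<noteq> 0" using assms(2)[of c] by (auto simp: h_def)
  then have hh: "h \<bullet> h > 0" by simp
  have hp: "h \<bullet> p = 0" "p \<bullet> h = 0"
    using pp by (simp_all add: h_def c_def inner_diff_left inner_diff_right inner_commute)
  define \<mu> where "\<mu> = sqrt (3 * (p \<bullet> p) / (h \<bullet> h)) / 2"
  have mu: "\<mu> > 0" "\<mu> * (\<mu> * (h \<bullet> h)) = 3 / 4 * (p \<bullet> p)"
  proof -
    show "\<mu> > 0" using pp hh by (simp add: \<mu>_def)
    have "\<mu> * \<mu> = 3 * (p \<bullet> p) / (h \<bullet> h) / 4"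
      using pp hh by (simp add: \<mu>_def)
    then show "\<mu> * (\<mu> * (h \<bullet> h)) = 3 / 4 * (p \<bullet> p)"
      using hh by (simp flip: mult.assoc)
  qed
  define g where "g = (1 / 2) *\<^sub>R p + \<mu> *\<^sub>R h"
  have "g \<bullet> g = p \<bullet> p" "g \<bullet> p = p \<bullet> p / 2"
    using mu(2) by (simp_all add: g_def inner_add_left inner_add_right hp)
  moreover have "q + (1 / (2 * \<mu>) - c) *\<^sub>R p = (1 / \<mu>) *\<^sub>R g"
    using mu(1) by (simp add: g_def h_def algebra_simps)
  ultimately show ?thesis using that[of "1 / \<mu>"] mu(1) by simp
qed

lemma floor_mult_over_tendsto:
  assumes "filterlim D at_top F"
  shows "((\<lambda>m. real_of_int \<lfloor>c * D m\<rfloor> / D m) \<longlongrightarrow> c) F"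
proof (rule tendsto_sandwich)
  have ev: "\<forall>\<^sub>F m in F. D m > 0"
    using assms by (simp add: filterlim_at_top_dense)
  show "\<forall>\<^sub>F m in F. c - 1 / D m \<le> real_of_int \<lfloor>c * D m\<rfloor> / D m"
    using ev
  proof eventually_elim
    case (elim m)
    have "c - 1 / D m = (c * D m - 1) / D m" using elim by (simp add: diff_divide_distrib)
    also have "\<dots> \<le> real_of_int \<lfloor>c * D m\<rfloor> / D m"
      using elim by (intro divide_right_mono) linarith+
    finally show ?case .
  qed
  show "\<forall>\<^sub>F m in F. real_of_int \<lfloor>c * D m\<rfloor> / D m \<le> c"
    using ev by eventually_elim (simp add: pos_divide_le_eq)
  have "((\<lambda>m. 1 / D m) \<longlongrightarrow> 0) F"
    using assms by (intro tendsto_divide_0[OF tendsto_const] filterlim_at_top_imp_at_infinity)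
  from tendsto_diff[OF tendsto_const this, of c]
  show "((\<lambda>m. c - 1 / D m) \<longlongrightarrow> c) F" by simp
qed simp

text \<open>The tolerance is relative to the common squared side \<open>a\<close>, so the notion is
  invariant under scaling. Squared lengths keep all computations within inner products.\<close>

definition nearly_equilateral :: "real \<Rightarrow> int^3^3 \<Rightarrow> bool" where
  "nearly_equilateral \<delta> T \<longleftrightarrow>
    (\<exists>a>0. \<forall>i j. i \<noteq> j \<longrightarrow> \<bar>(dist (vertex T i) (vertex T j))\<^sup>2 - a\<bar> \<le> \<delta> * a)"

text \<open>The numerators of a row are linear in the row, while the vertex is not.\<close>

definition affine_part :: "int^3 \<Rightarrow> real^2" where
  "affine_part r = vector [of_int (r $ 1), of_int (r $ 2)]"

lemma affine_part_add: "affine_part (r + s) = affine_part r + affine_part s"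
  by (simp add: affine_part_def vec_eq_iff forall_2)

lemma affine_part_smult: "affine_part (c *s r) = of_int c *\<^sub>R affine_part r"
  by (simp add: affine_part_def vec_eq_iff forall_2)

lemma vertex_affine_part: "vertex T i = (1 / of_int (T $ i $ 3)) *\<^sub>R affine_part (T $ i)"
  by (simp add: affine_part_def vec_eq_iff forall_2)

lemma affine_part_eq:
  "denom T i > 0 \<Longrightarrow> affine_part (T $ i) = of_int (denom T i) *\<^sub>R vertex T i"
  by (simp add: vertex_affine_part denom_def)

lemma noncollinear_vertices:
  assumes "unimodular T"
  shows "vertex T 1 \<noteq> vertex T 2"
    and "vertex T 3 - vertex T 1 \<noteq> c *\<^sub>R (vertex T 1 - vertex T 2)"
proof -
  have "(vertex T 3 $ 1 - vertex T 1 $ 1) * (vertex T 2 $ 2 - vertex T 1 $ 2)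
      \<noteq> (vertex T 2 $ 1 - vertex T 1 $ 1) * (vertex T 3 $ 2 - vertex T 1 $ 2)" (is ?ne)
    using assms det_eq_vertices[of T] by (auto simp: unimodular_def simp del: vertex_nth)
  then show "vertex T 1 \<noteq> vertex T 2" by (metis diff_self mult_zero_left mult_zero_right)
  show "vertex T 3 - vertex T 1 \<noteq> c *\<^sub>R (vertex T 1 - vertex T 2)"
  proof
    assume "vertex T 3 - vertex T 1 = c *\<^sub>R (vertex T 1 - vertex T 2)"
    then have "(vertex T 3 - vertex T 1) $ k = (c *\<^sub>R (vertex T 1 - vertex T 2)) $ k" for k
      by (rule arg_cong)
    then have eq: "vertex T 3 $ k - vertex T 1 $ k = c * (vertex T 1 $ k - vertex T 2 $ k)" for k
      by (simp only: vector_minus_component vector_scaleR_component real_scaleR_def)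
    from \<open>?ne\<close> show False
      unfolding eq by (simp add: algebra_simps del: vertex_nth)
  qed
qed

text \<open>Row operations reduce the new rows to s, r, t; the sign comes from the exchange of the
  first two.\<close>

lemma det_shear:
  fixes r s t :: "int^3"
  shows "det (vector [m *s r + s, r + (m *s r + s), t + k *s r + b *s (m *s r + s)] :: int^3^3)
    = - det (vector [r, s, t] :: int^3^3)"
  by (simp add: det_3 algebra_simps)

lemma nearly_equilateral_in_ball:
  assumes "e > 0" "\<delta> > 0"
  obtains T where "unimodular T" "triangle T \<subseteq> ball x e" "nearly_equilateral \<delta> T"
proof -
  obtain S where S: "unimodular S" "triangle S \<subseteq> ball x e"
    using unimodular_triangle_in_ball[OF assms(1)] by metis
  define r3 s3 t3 where rst_def: "r3 = real_of_int (denom S 1)" "s3 = real_of_int (denom S 2)"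
    "t3 = real_of_int (denom S 3)"
  have pos: "r3 > 0" "s3 > 0" "t3 > 0"
    using S(1) by (auto simp: rst_def unimodular_def)
  \<comment> \<open>The limit shape: with the sides scaled by the square of \<open>d m\<close>, V -
    U will tend to p and W - U to (q + \<open>\<kappa>\<close> p) / \<open>\<beta>\<close>, which is
    g.\<close>
  define p where "p = (r3 * s3) *\<^sub>R (vertex S 1 - vertex S 2)"
  define q where "q = t3 *\<^sub>R (vertex S 3 - vertex S 1)"
  have "p \<noteq> 0" using noncollinear_vertices(1)[OF S(1)] pos by (simp add: p_def)
  moreover have "q \<noteq> c *\<^sub>R p" for c
  proof
    assume "q = c *\<^sub>R p"
    then have "(1 / t3) *\<^sub>R q = (1 / t3) *\<^sub>R (c *\<^sub>R p)" by simp
    then have "vertex S 3 - vertex S 1 = (c * r3 * s3 / t3) *\<^sub>R (vertex S 1 - vertex S 2)"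
      using pos by (simp add: p_def q_def mult.assoc)
    then show False using noncollinear_vertices(2)[OF S(1)] by blast
  qed
  ultimately obtain \<kappa> \<beta> g where g: "\<beta> > 0" "q + \<kappa> *\<^sub>R p = \<beta> *\<^sub>R g"
      "g \<bullet> g = p \<bullet> p" "g \<bullet> p = p \<bullet> p / 2"
    using equilateral_completion by metis
  define D where "D = (\<lambda>m::nat. int m * denom S 1 + denom S 2)"
  \<comment> \<open>Rounding keeps the sheared matrix integral; only the limits
    \<open>\<kappa>\<close> and \<open>\<beta>\<close> of \<open>k m / d m\<close> and
    \<open>b m / d m\<close> matter.\<close>
  define k where "k = (\<lambda>m. \<lfloor>\<kappa> * D m\<rfloor>)"
  define b where "b = (\<lambda>m. \<lfloor>\<beta> * D m\<rfloor>)"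
  define u where "u = (\<lambda>m. int m *s S $ 1 + S $ 2)"
  define T where "T = (\<lambda>m. vector [u m, S $ 1 + u m, S $ 3 + k m *s S $ 1 + b m *s u m] :: int^3^3)"
  define d where "d = (\<lambda>m. real_of_int (D m))"
  define E where "E = (\<lambda>m. t3 + k m * r3 + b m * d m)"
  have d_eq: "d m = s3 + r3 * m" for m by (simp add: d_def D_def rst_def)
  have dpos: "d m > 0" for m using pos by (simp add: d_eq add_pos_nonneg)
  have dlim: "filterlim d at_top sequentially"
    unfolding d_eq[abs_def]
    by (intro filterlim_tendsto_add_at_top[OF tendsto_const]
      filterlim_tendsto_pos_mult_at_top[OF tendsto_const pos(1) filterlim_real_sequentially])
  have dinv: "(\<lambda>m. 1 / d m) \<longlonglongrightarrow> 0"
    using dlim by (intro tendsto_divide_0[OF tendsto_const] filterlim_at_top_imp_at_infinity)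
  have den: "denom (T m) 1 = d m" "denom (T m) 2 = r3 + d m" "denom (T m) 3 = E m" for m
    by (simp_all add: T_def u_def denom_def D_def d_def E_def rst_def algebra_simps)
  define R where "R = vertex S 1"
  define U V W where "U = (\<lambda>m. vertex (T m) 1)" "V = (\<lambda>m. vertex (T m) 2)" "W = (\<lambda>m. vertex (T m) 3)"
  have Tn: "T m $ 1 = u m" "T m $ 2 = S $ 1 + u m" "T m $ 3 = S $ 3 + k m *s S $ 1 + b m *s u m" for m
    by (simp_all add: T_def)
  have vertices: "U m = (1 / d m) *\<^sub>R affine_part (u m)"
    "V m = (1 / (r3 + d m)) *\<^sub>R affine_part (S $ 1 + u m)"
    "W m = (1 / E m) *\<^sub>R affine_part (S $ 3 + k m *s S $ 1 + b m *s u m)" for m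
    unfolding U_V_W_def vertex_affine_part den[unfolded denom_def] unfolding Tn by simp_all
  have aff: "affine_part (S $ 1) = r3 *\<^sub>R R" "affine_part (S $ 2) = s3 *\<^sub>R vertex S 2"
    "affine_part (S $ 3) = t3 *\<^sub>R vertex S 3"
    using S(1) by (simp_all add: affine_part_eq rst_def R_def unimodular_def)
  have affu: "affine_part (u m) = d m *\<^sub>R U m" for m
    using dpos[of m] by (simp add: vertices(1))
  \<comment> \<open>\<open>U m\<close> is the mean of \<open>R\<close> and \<open>vertex S 2\<close>
    with weights m r3 and s3, whose sum is \<open>d m\<close>.\<close>
  have RU: "r3 *\<^sub>R (R - U m) = (1 / d m) *\<^sub>R p" for m
  proof -
    have dU: "d m *\<^sub>R U m = (m * r3) *\<^sub>R R + s3 *\<^sub>R vertex S 2"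
      unfolding affu[symmetric] by (simp add: u_def affine_part_add affine_part_smult aff)
    have "d m *\<^sub>R (r3 *\<^sub>R (R - U m)) = r3 *\<^sub>R (d m *\<^sub>R R - d m *\<^sub>R U m)"
      by (simp add: algebra_simps)
    also have "\<dots> = p"
      unfolding dU by (simp add: p_def R_def d_eq algebra_simps)
    finally have "(1 / d m) *\<^sub>R (d m *\<^sub>R (r3 *\<^sub>R (R - U m))) = (1 / d m) *\<^sub>R p"
      by (rule arg_cong)
    then show ?thesis using dpos[of m] by simp
  qed
  have VU: "V m - U m = (1 / (d m * (r3 + d m))) *\<^sub>R p" for m
  proof -
    have "V m = (1 / (r3 + d m)) *\<^sub>R (r3 *\<^sub>R R + d m *\<^sub>R U m)"
      by (simp add: vertices(2) affine_part_add aff affu)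
    also have "r3 *\<^sub>R R + d m *\<^sub>R U m = (r3 + d m) *\<^sub>R U m + r3 *\<^sub>R (R - U m)"
      by (simp add: algebra_simps)
    finally show ?thesis
      using dpos[of m] pos by (simp add: RU scaleR_add_right)
  qed
  \<comment> \<open>\<open>W m\<close> is a weighted mean of \<open>vertex S 3\<close>,
    \<open>R\<close> and \<open>U m\<close>. The last drops out of the difference, so
    \<open>b m\<close> acts only through the denominator \<open>E m\<close>, that is, on the length,
    whereas \<open>k m\<close> also shears along p.\<close>
  have WU: "W m - U m = (1 / E m) *\<^sub>R (t3 *\<^sub>R (vertex S 3 - U m) + (k m / d m) *\<^sub>R p)"
    if "E m > 0" for m
  proof -
    have "W m = (1 / E m) *\<^sub>R (t3 *\<^sub>R vertex S 3 + k m *\<^sub>R r3 *\<^sub>R R + b m *\<^sub>R d m *\<^sub>R U m)"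
      by (simp add: vertices(3) affine_part_add affine_part_smult aff affu)
    also have "t3 *\<^sub>R vertex S 3 + k m *\<^sub>R r3 *\<^sub>R R + b m *\<^sub>R d m *\<^sub>R U m
        = E m *\<^sub>R U m + (t3 *\<^sub>R (vertex S 3 - U m) + k m *\<^sub>R r3 *\<^sub>R (R - U m))"
      by (simp add: E_def algebra_simps)
    finally show ?thesis
      using that by (simp add: RU scaleR_add_right)
  qed
  have klim: "(\<lambda>m. k m / d m) \<longlonglongrightarrow> \<kappa>" and blim: "(\<lambda>m. b m / d m) \<longlonglongrightarrow> \<beta>"
    using floor_mult_over_tendsto[OF dlim] by (simp_all add: k_def b_def d_def)
  have "U = (\<lambda>m. R - (1 / r3) *\<^sub>R ((1 / d m) *\<^sub>R p))"
    using pos by (intro ext) (simp flip: RU)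
  moreover have "(\<lambda>m. R - (1 / r3) *\<^sub>R ((1 / d m) *\<^sub>R p)) \<longlonglongrightarrow> R - (1 / r3) *\<^sub>R (0 *\<^sub>R p)"
    by (intro tendsto_intros dinv)
  ultimately have Ulim: "U \<longlonglongrightarrow> R" by simp
  define P where "P = (\<lambda>m. (d m)\<^sup>2 *\<^sub>R (V m - U m))"
  define G where "G = (\<lambda>m. (d m)\<^sup>2 *\<^sub>R (W m - U m))"
  have Plim: "P \<longlonglongrightarrow> p"
  proof -
    have "P = (\<lambda>m. (1 / (r3 * (1 / d m) + 1)) *\<^sub>R p)"
    proof
      fix m
      show "P m = (1 / (r3 * (1 / d m) + 1)) *\<^sub>R p"
        using dpos[of m] pos by (simp add: P_def VU divide_simps power2_eq_square)
    qed
    moreover have "(\<lambda>m. (1 / (r3 * (1 / d m) + 1)) *\<^sub>R p) \<longlonglongrightarrow> (1 / (r3 * 0 + 1)) *\<^sub>R p"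
      by (intro tendsto_intros dinv) simp
    ultimately show ?thesis by simp
  qed
  \<comment> \<open>The term \<open>b m * d m\<close> dominates \<open>E m\<close>; the others are
    of lower order than the square of \<open>d m\<close>.\<close>
  have E2lim: "(\<lambda>m. E m / (d m)\<^sup>2) \<longlonglongrightarrow> \<beta>"
  proof -
    have "(\<lambda>m. E m / (d m)\<^sup>2)
        = (\<lambda>m. t3 * (1 / d m) * (1 / d m) + (k m / d m) * r3 * (1 / d m) + b m / d m)"
    proof
      fix m
      show "E m / (d m)\<^sup>2 = t3 * (1 / d m) * (1 / d m) + (k m / d m) * r3 * (1 / d m) + b m / d m"
        using dpos[of m] by (simp add: E_def add_divide_distrib power2_eq_square)
    qed
    moreover have "(\<lambda>m. t3 * (1 / d m) * (1 / d m) + (k m / d m) * r3 * (1 / d m) + b m / d m)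
        \<longlonglongrightarrow> t3 * 0 * 0 + \<kappa> * r3 * 0 + \<beta>"
      by (intro tendsto_intros dinv klim blim)
    ultimately show ?thesis by simp
  qed
  have Epos: "\<forall>\<^sub>F m in sequentially. E m > 0"
    using order_tendstoD(1)[OF E2lim g(1)]
    by eventually_elim (use dpos in \<open>simp add: zero_less_divide_iff\<close>)
  have Glim: "G \<longlonglongrightarrow> g"
  proof -
    have "(\<lambda>m. (1 / (E m / (d m)\<^sup>2)) *\<^sub>R (t3 *\<^sub>R (vertex S 3 - U m) + (k m / d m) *\<^sub>R p))
        \<longlonglongrightarrow> (1 / \<beta>) *\<^sub>R (t3 *\<^sub>R (vertex S 3 - R) + \<kappa> *\<^sub>R p)"
      using g(1) by (intro tendsto_intros E2lim klim Ulim) simp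
    also have "(1 / \<beta>) *\<^sub>R (t3 *\<^sub>R (vertex S 3 - R) + \<kappa> *\<^sub>R p) = g"
      using g(1,2) by (simp add: q_def R_def)
    finally show ?thesis
      by (rule Lim_transform_eventually)
        (use Epos in eventually_elim, simp add: G_def WU)
  qed
  have dinv2: "(\<lambda>m. (1 / d m) * (1 / d m)) \<longlonglongrightarrow> 0"
    using tendsto_mult[OF dinv dinv] by simp
  have "d m \<noteq> 0" for m using dpos[of m] by simp
  then have "V = (\<lambda>m. U m + ((1 / d m) * (1 / d m)) *\<^sub>R P m)"
    "W = (\<lambda>m. U m + ((1 / d m) * (1 / d m)) *\<^sub>R G m)"
    by (simp_all add: fun_eq_iff P_def G_def power2_eq_square)
  then have Vlim: "V \<longlonglongrightarrow> R" and Wlim: "W \<longlonglongrightarrow> R"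
    using tendsto_add[OF Ulim tendsto_scaleR[OF dinv2 Plim]]
      tendsto_add[OF Ulim tendsto_scaleR[OF dinv2 Glim]] by simp_all
  have "R \<in> triangle S" by (auto simp: R_def triangle_def intro: hull_inc)
  then have "R \<in> ball x e" using S(2) by blast
  then have inball: "\<forall>\<^sub>F m in sequentially. U m \<in> ball x e \<and> V m \<in> ball x e \<and> W m \<in> ball x e"
    using topological_tendstoD[OF Ulim open_ball] topological_tendstoD[OF Vlim open_ball]
      topological_tendstoD[OF Wlim open_ball] by (simp add: eventually_conj_iff)
  define n where "n = p \<bullet> p"
  have npos: "n > 0" using \<open>p \<noteq> 0\<close> by (simp add: n_def)
  have close: "\<forall>\<^sub>F m in sequentially. \<bar>f m \<bullet> f m - n\<bar> < \<delta> * n"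
    if "f \<longlonglongrightarrow> l" "l \<bullet> l = n" for f and l :: "real^2"
  proof -
    have "(\<lambda>m. f m \<bullet> f m) \<longlonglongrightarrow> n"
      using tendsto_inner[OF that(1) that(1)] that(2) by simp
    then show ?thesis
      using tendstoD[of _ n sequentially "\<delta> * n"] npos assms(2) by (simp add: dist_real_def)
  qed
  \<comment> \<open>The limits p, g and p - g of the three rescaled sides all have squared length n,
    because the inner product of g and p is n/2.\<close>
  have "\<forall>\<^sub>F m in sequentially. \<bar>P m \<bullet> P m - n\<bar> < \<delta> * n"
    "\<forall>\<^sub>F m in sequentially. \<bar>G m \<bullet> G m - n\<bar> < \<delta> * n"
    "\<forall>\<^sub>F m in sequentially. \<bar>(P m - G m) \<bullet> (P m - G m) - n\<bar> < \<delta> * n"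
    using g(3,4)
    by (intro close[OF Plim] close[OF Glim] close[OF tendsto_diff[OF Plim Glim]];
        simp add: n_def inner_diff_left inner_diff_right inner_commute[of p g])+
  with Epos inball have "\<forall>\<^sub>F m in sequentially. E m > 0
      \<and> (U m \<in> ball x e \<and> V m \<in> ball x e \<and> W m \<in> ball x e) \<and> \<bar>P m \<bullet> P m - n\<bar> < \<delta> * n
      \<and> \<bar>G m \<bullet> G m - n\<bar> < \<delta> * n \<and> \<bar>(P m - G m) \<bullet> (P m - G m) - n\<bar> < \<delta> * n"
    by eventually_elim blast
  then obtain m where m: "E m > 0" "U m \<in> ball x e" "V m \<in> ball x e" "W m \<in> ball x e"
      "\<bar>P m \<bullet> P m - n\<bar> < \<delta> * n" "\<bar>G m \<bullet> G m - n\<bar> < \<delta> * n"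
      "\<bar>(P m - G m) \<bullet> (P m - G m) - n\<bar> < \<delta> * n"
    by (auto dest: eventually_happens'[OF sequentially_bot])
  show ?thesis
  proof (rule that)
    have "vector [S $ 1, S $ 2, S $ 3] = S"
      by (simp add: vec_eq_iff forall_3)
    then have "det (T m) = - det S"
      unfolding T_def u_def by (simp only: det_shear)
    moreover have "\<forall>i. denom (T m) i > 0"
      using den[of m] m(1) dpos[of m] pos unfolding forall_3
      by (metis add_pos_pos of_int_0_less_iff)
    ultimately show "unimodular (T m)"
      using S(1) by (auto simp: unimodular_def)
    show "triangle (T m) \<subseteq> ball x e"
      unfolding triangle_eq using m(2-4) by (intro hull_minimal) (auto simp: U_V_W_def)
    \<comment> \<open>This factor undoes the scaling: lengths were multiplied by the square of
      \<open>d m\<close>, squared lengths by its fourth power.\<close>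
    define a where "a = 1 / (d m)^4"
    have a: "a > 0" using dpos[of m] by (simp add: a_def)
    have sq: "(dist x y)\<^sup>2 = a * (z \<bullet> z)" if "(d m)\<^sup>2 *\<^sub>R (x - y) = z" for x y z :: "real^2"
    proof -
      have "z \<bullet> z = (d m)^4 * ((x - y) \<bullet> (x - y))"
        by (simp flip: that add: power4_eq_xxxx power2_eq_square)
      then show ?thesis
        using dpos[of m] by (simp add: a_def dist_norm power2_norm_eq_inner)
    qed
    have scaled: "\<bar>a * y - a * n\<bar> \<le> \<delta> * (a * n)" if "\<bar>y - n\<bar> < \<delta> * n" for y
    proof -
      have "\<bar>a * y - a * n\<bar> = a * \<bar>y - n\<bar>"
        using a by (simp add: abs_mult flip: right_diff_distrib)
      also have "\<dots> \<le> a * (\<delta> * n)" using a that by simp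
      finally show ?thesis by (simp add: mult_ac)
    qed
    have "(dist (V m) (U m))\<^sup>2 = a * (P m \<bullet> P m)" "(dist (W m) (U m))\<^sup>2 = a * (G m \<bullet> G m)"
      "(dist (V m) (W m))\<^sup>2 = a * ((P m - G m) \<bullet> (P m - G m))"
      by (intro sq; simp add: P_def G_def algebra_simps)+
    then have near: "\<bar>(dist (V m) (U m))\<^sup>2 - a * n\<bar> \<le> \<delta> * (a * n)"
      "\<bar>(dist (W m) (U m))\<^sup>2 - a * n\<bar> \<le> \<delta> * (a * n)"
      "\<bar>(dist (V m) (W m))\<^sup>2 - a * n\<bar> \<le> \<delta> * (a * n)"
      using m(5-7) by (simp_all only: scaled)
    have "\<bar>(dist (vertex (T m) i) (vertex (T m) j))\<^sup>2 - a * n\<bar> \<le> \<delta> * (a * n)" if "i \<noteq> j" for i j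
      using that near[unfolded U_V_W_def] near[unfolded U_V_W_def, unfolded dist_commute[of "vertex (T m) 2"]]
        near[unfolded U_V_W_def, unfolded dist_commute[of "vertex (T m) 3"]] exhaust_3[of i] exhaust_3[of j]
      by metis
    then show "nearly_equilateral \<delta> (T m)"
      unfolding nearly_equilateral_def using a npos by (intro exI[of _ "a * n"]) simp
  qed
qed

section \<open>Angles, sides and areas of near-equilateral triangles\<close>

lemma angle_gt_of_nearly_equal_sides:
  assumes "n > 0" "\<bar>(dist a b)\<^sup>2 - n\<bar> \<le> 1 / 100 * n" "\<bar>(dist c b)\<^sup>2 - n\<bar> \<le> 1 / 100 * n"
    "\<bar>(dist a c)\<^sup>2 - n\<bar> \<le> 1 / 100 * n"
  shows "angle a b c > arcsin (sqrt 23 / 6)"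
proof -
  define p q where "p = a - b" "q = c - b"
  \<comment> \<open>By the law of cosines twice the inner product is at most (101 + 101 - 99)/100
    n.\<close>
  have pq: "(norm p)\<^sup>2 \<ge> 99 / 100 * n" "(norm q)\<^sup>2 \<ge> 99 / 100 * n" "p \<bullet> q \<le> 103 / 200 * n"
  proof -
    have "2 * (p \<bullet> q) = (norm p)\<^sup>2 + (norm q)\<^sup>2 - (norm (p - q))\<^sup>2"
      unfolding power2_norm_eq_inner by (simp add: inner_diff_left inner_diff_right inner_commute)
    moreover have "norm (p - q) = dist a c" "norm p = dist a b" "norm q = dist c b"
      by (simp_all add: p_q_def dist_norm)
    ultimately show "(norm p)\<^sup>2 \<ge> 99 / 100 * n" "(norm q)\<^sup>2 \<ge> 99 / 100 * n" "p \<bullet> q \<le> 103 / 200 * n"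
      using assms(2-4) by (auto simp only: abs_le_iff; linarith)+
  qed
  have "(99 / 100 * n)\<^sup>2 \<le> (norm p * norm q)\<^sup>2"
    unfolding power2_eq_square[of "99 / 100 * n"] power_mult_distrib[of "norm p"]
    by (rule mult_mono) (use pq assms(1) in auto)
  then have nn: "99 / 100 * n \<le> norm p * norm q"
    by (rule power2_le_imp_le) simp
  define y where "y = (p \<bullet> q) / (norm p * norm q)"
  have npos: "norm p * norm q > 0" using nn assms(1) by linarith
  have "y \<le> 3 / 5"
    unfolding y_def using npos pq(3) nn assms(1) by (simp add: pos_divide_le_eq)
  \<comment> \<open>The square of 18/5 is 12.96 < 13. The number \<open>sqrt 13 / 6\<close> is the
    cosine of the critical angle, since 13 + 23 = 36.\<close>
  moreover have "3 / 5 < sqrt 13 / 6"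
    using real_less_rsqrt[of "18 / 5" 13] by (simp add: power2_eq_square)
  moreover have "- (norm p * norm q) \<le> p \<bullet> q"
    using Cauchy_Schwarz_ineq2[of p q] by linarith
  then have "- 1 \<le> y"
    unfolding y_def using npos by (simp add: pos_le_divide_eq)
  moreover have "sqrt 13 / 6 \<le> 1"
    using real_sqrt_le_mono[of 13 36] by simp
  ultimately have "arccos (sqrt 13 / 6) < arccos y"
    by (intro arccos_less_arccos) auto
  moreover have "arcsin (sqrt 23 / 6) = arccos (sqrt 13 / 6)"
  proof -
    have le: "sqrt 23 / 6 \<le> 1" using real_sqrt_le_mono[of 23 36] by simp
    have "- 1 \<le> sqrt 23 / 6" by (rule order_trans[of _ 0]) auto
    then have "cos (arcsin (sqrt 23 / 6)) = sqrt (1 - (sqrt 23 / 6)\<^sup>2)"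
      using le by (intro cos_arcsin)
    also have "\<dots> = sqrt 13 / 6"
      by (simp add: power_divide real_sqrt_divide)
    finally have "arccos (sqrt 13 / 6) = arccos (cos (arcsin (sqrt 23 / 6)))" by (simp only:)
    also have "\<dots> = arcsin (sqrt 23 / 6)"
    proof (rule arccos_cos)
      show "0 \<le> arcsin (sqrt 23 / 6)"
        using arcsin_le_arcsin[of 0 "sqrt 23 / 6"] le by simp
      show "arcsin (sqrt 23 / 6) \<le> pi"
        using arcsin_bounded[of "sqrt 23 / 6"] le \<open>- 1 \<le> sqrt 23 / 6\<close> pi_gt_zero by linarith
    qed
    finally show ?thesis ..
  qed
  ultimately show ?thesis
    by (simp add: angle_def y_def p_q_def)
qed

lemma finite_sides: "finite {dist (vertex T i) (vertex T j) | i j. i \<noteq> j}"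
  by (rule finite_subset[of _ "(\<lambda>(i, j). dist (vertex T i) (vertex T j)) ` UNIV"]) auto

lemma dist_le_longest_side: "dist (vertex T i) (vertex T j) \<le> longest_side T"
proof -
  have *: "dist (vertex T i) (vertex T j) \<le> longest_side T" if "i \<noteq> j" for i j
    unfolding longest_side_def using that by (intro Max_ge finite_sides) auto
  then have "0 \<le> longest_side T" using zero_le_dist order_trans[OF _ *[of 1 2]] by simp
  then show ?thesis using * by (cases "i = j") auto
qed

lemma longest_side_attained: "\<exists>i j. i \<noteq> j \<and> longest_side T = dist (vertex T i) (vertex T j)"
proof -
  have "(1::3) \<noteq> 2" by simp
  then have "longest_side T \<in> {dist (vertex T i) (vertex T j) | i j. i \<noteq> j}"
    unfolding longest_side_def by (intro Max_in finite_sides) blast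
  then show ?thesis by auto
qed

text \<open>A closed ball about a vertex is convex, so it contains the triangle once it contains the
  vertices. This gives the first inequality between the limits.\<close>

lemma dist_vertex_le_longest_side:
  assumes "x \<in> triangle T"
  shows "dist x (vertex T i) \<le> longest_side T"
proof -
  have "triangle T \<subseteq> cball (vertex T i) (longest_side T)"
    unfolding triangle_def using dist_le_longest_side by (intro hull_minimal) auto
  then show ?thesis using assms by (auto simp: dist_commute)
qed

text \<open>Lagrange's identity for the cross product of two sides.\<close>

lemma four_area_squared:
  assumes "\<forall>i. denom T i > 0"
  shows "4 * (area T)\<^sup>2 = (dist (vertex T 2) (vertex T 1))\<^sup>2 * (dist (vertex T 3) (vertex T 1))\<^sup>2
    - ((vertex T 2 - vertex T 1) \<bullet> (vertex T 3 - vertex T 1))\<^sup>2"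
proof -
  define p q where "p = vertex T 2 - vertex T 1" "q = vertex T 3 - vertex T 1"
  let ?d = "real_of_int (denom T 1 * denom T 2 * denom T 3)"
  have d: "?d > 0" using assms by simp
  have "real_of_int (det T) = - (q $ 1 * p $ 2 - p $ 1 * q $ 2) * ?d"
    unfolding det_eq_vertices[OF assms] p_q_def by (simp only: vector_minus_component)
  then have "\<bar>real_of_int (det T)\<bar> = \<bar>q $ 1 * p $ 2 - p $ 1 * q $ 2\<bar> * ?d"
    using d by (simp only: abs_mult abs_minus_cancel abs_of_pos)
  then have "2 * area T = \<bar>q $ 1 * p $ 2 - p $ 1 * q $ 2\<bar>"
    unfolding area_eq[OF assms] using assms[rule_format, of 1] assms[rule_format, of 2] assms[rule_format, of 3]
    by simp
  then have "(2 * area T)\<^sup>2 = (q $ 1 * p $ 2 - p $ 1 * q $ 2)\<^sup>2" by simp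
  also have "\<dots> = (p \<bullet> p) * (q \<bullet> q) - (p \<bullet> q)\<^sup>2"
    by (simp add: inner_vec_def sum_2 power2_eq_square algebra_simps)
  finally show ?thesis
    by (simp add: p_q_def dist_norm power2_norm_eq_inner power_mult_distrib)
qed

lemma area_pos:
  assumes "unimodular T"
  shows "area T > 0"
  using assms by (auto simp: area_eq unimodular_def)

text \<open>An equilateral triangle gives the constant 16/3. A tolerance of 1/100 raises it to less
  than 6, well below 208/23, the fourth power of the bound in the theorem.\<close>

lemma longest_side_power4_le:
  assumes "unimodular T" "nearly_equilateral (1 / 100) T"
  shows "(longest_side T)^4 \<le> 6 * (area T)\<^sup>2"
proof -
  obtain n where n: "n > 0"
    "\<And>i j. i \<noteq> j \<Longrightarrow> \<bar>(dist (vertex T i) (vertex T j))\<^sup>2 - n\<bar> \<le> 1 / 100 * n"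
    using assms(2) by (auto simp: nearly_equilateral_def)
  obtain i j where ij: "i \<noteq> j" "longest_side T = dist (vertex T i) (vertex T j)"
    using longest_side_attained by blast
  have "(longest_side T)\<^sup>2 \<le> 101 / 100 * n"
    using n(2)[OF ij(1)] by (simp only: ij(2) abs_le_iff; linarith)
  then have "((longest_side T)\<^sup>2)\<^sup>2 \<le> (101 / 100 * n)\<^sup>2"
    by (intro power_mono) auto
  then have L: "(longest_side T)^4 \<le> 10201 / 10000 * n\<^sup>2"
    by (simp add: power_mult_distrib power_divide flip: power_mult)
  define p q where "p = vertex T 2 - vertex T 1" "q = vertex T 3 - vertex T 1"
  have bounds: "\<bar>(norm p)\<^sup>2 - n\<bar> \<le> 1 / 100 * n" "\<bar>(norm q)\<^sup>2 - n\<bar> \<le> 1 / 100 * n"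
    "\<bar>(norm (p - q))\<^sup>2 - n\<bar> \<le> 1 / 100 * n"
    using n(2)[of 2 1] n(2)[of 3 1] n(2)[of 2 3] by (simp_all add: p_q_def dist_norm)
  have "2 * (p \<bullet> q) = (norm p)\<^sup>2 + (norm q)\<^sup>2 - (norm (p - q))\<^sup>2"
    unfolding power2_norm_eq_inner by (simp add: inner_diff_left inner_diff_right inner_commute)
  then have "\<bar>p \<bullet> q\<bar> \<le> 103 / 200 * n"
    using bounds n(1) by linarith
  then have "(p \<bullet> q)\<^sup>2 \<le> (103 / 200 * n)\<^sup>2"
    by (metis abs_le_square_iff abs_of_nonneg abs_ge_zero order_trans)
  moreover have "(99 / 100 * n) * (99 / 100 * n) \<le> (norm p)\<^sup>2 * (norm q)\<^sup>2"
    using bounds n(1) by (intro mult_mono) (auto simp only: abs_le_iff; linarith)+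
  moreover have "4 * (area T)\<^sup>2 = (norm p)\<^sup>2 * (norm q)\<^sup>2 - (p \<bullet> q)\<^sup>2"
    using four_area_squared[of T] assms(1) by (simp add: p_q_def dist_norm unimodular_def)
  moreover have "(103 / 200 * n)\<^sup>2 = 10609 / 40000 * n\<^sup>2" "99 / 100 * n * (99 / 100 * n) = 9801 / 10000 * n\<^sup>2"
    by (simp_all add: power2_eq_square)
  ultimately have "4 * (area T)\<^sup>2 \<ge> 7 / 10 * n\<^sup>2"
    using zero_le_power2[of n] by linarith
  then show ?thesis using L zero_le_power2[of n] by linarith
qed

text \<open>A convex set with empty interior is negligible, but the area is positive.\<close>

lemma interior_triangle_nonempty:
  assumes "unimodular T"
  shows "interior (triangle T) \<noteq> {}"
proof
  assume "interior (triangle T) = {}"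
  then have "negligible (triangle T)"
    by (simp add: negligible_convex_interior triangle_def)
  then show False
    using area_pos[OF assms] by (simp add: area_def negligible_imp_measure0)
qed

section \<open>Rank of finitely generated subgroups of the reals\<close>

lemma clear_denominators:
  fixes u :: "'a \<Rightarrow> rat"
  assumes "finite A"
  shows "\<exists>N w. N \<noteq> (0::int) \<and> (\<forall>v\<in>A. of_int N * u v = of_int (w v))"
  using assms
proof (induction A)
  case empty
  show ?case by (intro exI[of _ 1]) simp
next
  case (insert a A)
  then obtain N w where Nw: "N \<noteq> 0" "\<forall>v\<in>A. of_int N * u v = of_int (w v)" by blast
  obtain r s where rs: "s > 0" "u a = of_int r / of_int s"
    by (metis Fract_of_int_quotient Rat_cases)
  have "of_int (N * s) * u v = of_int (if v = a then N * r else s * w v)" if "v \<in> insert a A" for v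
    using that rs Nw(2) by (auto simp: mult_ac)
  then show ?case using Nw(1) rs(1)
    by (intro exI[of _ "N * s"] exI[of _ "\<lambda>v. if v = a then N * r else s * w v"]) auto
qed

interpretation rat_real: vector_space "\<lambda>(q::rat) (x::real). of_rat q * x"
  by unfold_locales (auto simp: algebra_simps of_rat_add of_rat_mult)

lemma rat_independent_if_int_independent:
  assumes "int_real.independent B"
  shows "rat_real.independent B"
proof
  assume "rat_real.dependent B"
  then obtain A u v where A: "finite A" "A \<subseteq> B" "(\<Sum>v\<in>A. of_rat (u v) * v) = 0" "v \<in> A" "u v \<noteq> 0"
    unfolding rat_real.dependent_explicit by blast
  obtain N w where N: "N \<noteq> 0" "\<forall>v\<in>A. of_int N * u v = of_int (w v)"
    using clear_denominators[OF A(1)] by blast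
  have w: "real_of_int (w v) = of_int N * of_rat (u v)" if "v \<in> A" for v
    by (metis N(2) that of_rat_mult of_rat_of_int_eq)
  have "(\<Sum>v\<in>A. of_int (w v) * v) = of_int N * (\<Sum>v\<in>A. of_rat (u v) * v)"
    by (simp add: sum_distrib_left w mult.assoc)
  then have "w v = 0"
    using int_real.independentD[OF assms A(1,2) _ A(4), of w] A(3) by simp
  then show False using w[OF A(4)] N(1) A(5) by simp
qed

text \<open>The bound on independent subsets is Steinitz exchange, which is applied over the field
  of rationals: clearing denominators shows that integer independence implies rational
  independence.\<close>

lemma has_rank_span:
  assumes "finite B" "int_real.independent B"
  shows "has_rank (int_real.span B) (card B)"
  unfolding has_rank_def
proof (intro conjI allI impI)
  show "\<exists>C\<subseteq>int_real.span B. finite C \<and> card C = card B \<and> int_real.independent C"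
    using assms int_real.span_superset by blast
  fix C assume C: "C \<subseteq> int_real.span B" "int_real.independent C"
  have "int_real.span B \<subseteq> rat_real.span B"
  proof
    fix x assume "x \<in> int_real.span B"
    then show "x \<in> rat_real.span B"
    proof (induction rule: int_real.span_induct_alt)
      case base
      show ?case by (rule rat_real.span_zero)
    next
      case (step c x y)
      have "of_rat (of_int c) * x \<in> rat_real.span B"
        using step(1) by (intro rat_real.span_scale rat_real.span_base)
      then show ?case using step(2) rat_real.span_add by simp
    qed
  qed
  then show "finite C" "card C \<le> card B"
    using rat_real.independent_span_bound[OF assms(1) rat_independent_if_int_independent[OF C(2)]] C(1)
    by auto
qed

lemma rank3_pointI:
  assumes "\<And>a b c :: int. (a, b, c) \<noteq> (0, 0, 0) \<Longrightarrow> of_int a * x $ 1 + of_int b * x $ 2 + of_int c \<noteq> (0::real)"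
  shows "rank3_point x"
proof -
  \<comment> \<open>The three generators are distinct, so the set has three elements and a function
    on it amounts to three separate coefficients.\<close>
  have ne: "x $ 1 \<noteq> x $ 2" "x $ 1 \<noteq> 1" "x $ 2 \<noteq> 1"
    using assms[of 1 "- 1" 0] assms[of 1 0 "- 1"] assms[of 0 1 "- 1"] by auto
  have "int_real.independent {x $ 1, x $ 2, 1}"
  proof
    assume "int_real.dependent {x $ 1, x $ 2, 1}"
    then obtain u where "\<exists>v\<in>{x $ 1, x $ 2, 1}. u v \<noteq> 0"
        "(\<Sum>v\<in>{x $ 1, x $ 2, 1}. of_int (u v) * v) = 0"
      by (auto simp only: int_real.dependent_finite finite.intros)
    then show False
      using assms[of "u (x $ 1)" "u (x $ 2)" "u 1"] ne by auto
  qed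
  then show ?thesis
    using has_rank_span[of "{x $ 1, x $ 2, 1}"] ne by (simp add: numeral_3_eq_3 rank3_point_def)
qed

section \<open>Baire category\<close>

text \<open>Smallness is required around every point of the triangle, so the condition does not
  mention the point to be approximated.\<close>

definition small_equilateral :: "nat \<Rightarrow> int^3^3 \<Rightarrow> bool" where
  "small_equilateral n T \<longleftrightarrow> unimodular T \<and> nearly_equilateral (1 / 100) T
    \<and> (\<forall>y\<in>triangle T. triangle T \<subseteq> ball y (1 / (n + 1)))"

text \<open>Interiors make the first condition a countable intersection of open sets; the second
  excludes all rational lines and yields rank 3.\<close>

definition good_points :: "(real^2) set" where
  "good_points = {x. (\<forall>n. \<exists>T. small_equilateral n T \<and> x \<in> interior (triangle T)) \<and>
    (\<forall>a b c :: int. (a, b, c) \<noteq> (0, 0, 0) \<longrightarrow> of_int a * x $ 1 + of_int b * x $ 2 + of_int c \<noteq> (0::real))}"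

lemma closure_small_equilateral_triangles: "closure (\<Union>T\<in>Collect (small_equilateral n). interior (triangle T)) = UNIV"
proof (intro set_eqI iffI UNIV_I)
  fix x :: "real^2"
  have "\<exists>y\<in>\<Union>T\<in>Collect (small_equilateral n). interior (triangle T). dist y x < e" if "e > 0" for e
  proof -
    \<comment> \<open>Two points of a ball of radius r are less than 2r apart, hence the factor
      2.\<close>
    define r where "r = min e (1 / (2 * (real n + 1)))"
    have r: "r > 0" "r \<le> e" "2 * r \<le> 1 / (real n + 1)"
      using that by (auto simp: r_def min_def field_simps)
    obtain T where T: "unimodular T" "triangle T \<subseteq> ball x r" "nearly_equilateral (1 / 100) T"
      using nearly_equilateral_in_ball[OF r(1), of "1 / 100"] by (metis zero_less_divide_1_iff zero_less_numeral)
    have "z \<in> ball y (1 / (real n + 1))" if "y \<in> triangle T" "z \<in> triangle T" for y z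
    proof -
      have "dist x y < r" "dist x z < r" using T(2) that by auto
      then show ?thesis using r(3) dist_triangle3[of y z x] by (simp add: dist_commute)
    qed
    then have "small_equilateral n T" using T by (auto simp: small_equilateral_def)
    moreover obtain y where y: "y \<in> interior (triangle T)"
      using interior_triangle_nonempty[OF T(1)] by blast
    moreover have "dist y x < e"
      using T(2) y interior_subset[of "triangle T"] r(2) by (force simp: dist_commute)
    ultimately show ?thesis by blast
  qed
  then show "x \<in> closure (\<Union>T\<in>Collect (small_equilateral n). interior (triangle T))"
    by (simp add: closure_approachable)
qed

lemma closure_off_line:
  assumes "(a, b, c) \<noteq> (0::real, 0::real, 0)"
  shows "closure {x::real^2. a * x $ 1 + b * x $ 2 + c \<noteq> 0} = UNIV"
proof (cases "a = 0 \<and> b = 0")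
  case True
  then show ?thesis using assms by simp
next
  case False
  define v :: "real^2" where "v = vector [a, b]"
  have "v \<noteq> 0" using False by (auto simp: v_def vec_eq_iff forall_2)
  have "{x::real^2. a * x $ 1 + b * x $ 2 + c \<noteq> 0} = - {x. v \<bullet> x = - c}"
    by (auto simp: v_def inner_vec_def sum_2)
  then show ?thesis
    using interior_hyperplane[OF \<open>v \<noteq> 0\<close>, of "- c"] by (simp add: closure_complement)
qed

lemma closure_good_points: "closure good_points = UNIV"
proof -
  define G where "G = (\<lambda>n. \<Union>T\<in>Collect (small_equilateral n). interior (triangle T))"
  define H where "H = (\<lambda>(a :: int, b :: int, c :: int).
    {x :: real^2. of_int a * x $ 1 + of_int b * x $ 2 + of_int c \<noteq> (0::real)})"
  \<comment> \<open>All triangles of one level are merged into a single open set, so the family is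
    indexed by the naturals and the integer triples and is countable.\<close>
  define \<G> where "\<G> = range G \<union> H ` (- {(0, 0, 0)})"
  have "UNIV \<subseteq> closure (\<Inter>\<G>)"
  proof (rule Baire)
    show "countable \<G>" by (simp add: \<G>_def)
    fix X assume "X \<in> \<G>"
    then consider n where "X = G n" | a b c where "X = H (a, b, c)" "(a, b, c) \<noteq> (0, 0, 0)"
      by (auto simp: \<G>_def)
    then have "open X \<and> closure X = UNIV"
    proof cases
      case 1
      then show ?thesis using closure_small_equilateral_triangles by (auto simp: G_def)
    next
      case 2
      have "open X"
        unfolding 2(1) H_def by (auto intro!: open_Collect_neq continuous_intros)
      moreover have "closure X = UNIV"
        unfolding 2(1) H_def using closure_off_line[of a b c] 2(2) by auto
      ultimately show ?thesis by blast
    qed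
    then show "openin (top_of_set UNIV) X \<and> UNIV \<subseteq> closure X" by simp
  qed simp
  also have "\<Inter>\<G> = {x. (\<forall>n. x \<in> G n) \<and> (\<forall>t. t \<noteq> (0, 0, 0) \<longrightarrow> x \<in> H t)}"
    unfolding \<G>_def Inter_Un_distrib by auto
  also have "\<dots> = good_points"
    unfolding split_paired_All by (simp add: G_def H_def good_points_def)
  finally show ?thesis by blast
qed

section \<open>Convergence of the quotients and choice of the expansion\<close>

lemma dehomogenized_area:
  assumes "unimodular T"
  shows "(2 * real_of_int (denom T 1) * real_of_int (denom T 2) * real_of_int (denom T 3)) powr (- 1 / 2)
    = area T powr (1 / 2)"
proof -
  have "area T = inverse (2 * real_of_int (denom T 1) * real_of_int (denom T 2) * real_of_int (denom T 3))"
    using assms by (auto simp: area_eq unimodular_def inverse_eq_divide)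
  moreover have "2 * real_of_int (denom T 1) * real_of_int (denom T 2) * real_of_int (denom T 3) > 0"
    using assms by (simp add: unimodular_def)
  moreover have "y powr (- 1 / 2) = inverse y powr (1 / 2)" if "y > 0" for y :: real
    using that powr_minus[of y "1 / 2"] inverse_powr[of y "1 / 2"] by simp
  ultimately show ?thesis by (simp only:)
qed

text \<open>Fourth powers remove the square root of the area here and the fourth root in the final
  bound.\<close>

lemma sides_ratio_power4_le:
  assumes "unimodular T" "nearly_equilateral (1 / 100) T"
  shows "(longest_side T / area T powr (1 / 2)) ^ 4 \<le> 6"
proof -
  have "(area T powr (1 / 2)) ^ 4 = (area T)\<^sup>2"
    using area_pos[OF assms(1)] by (simp add: powr_power)
  then show ?thesis
    using longest_side_power4_le[OF assms] area_pos[OF assms(1)]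
    by (simp add: power_divide pos_divide_le_eq)
qed

lemma inter_triangles_eq:
  assumes "\<And>n. x \<in> triangle (T n)" "\<And>n. triangle (T n) \<subseteq> ball x (1 / (real n + 1))"
  shows "(\<Inter>n. triangle (T n)) = {x}"
proof -
  have "y = x" if "\<And>n. y \<in> triangle (T n)" for y
  proof (rule ccontr)
    assume "y \<noteq> x"
    then obtain n where "inverse (real (Suc n)) < dist x y"
      using reals_Archimedean[of "dist x y"] by auto
    moreover have "dist x y < 1 / (real n + 1)" using assms(2)[of n] that[of n] by auto
    ultimately show False by (simp add: inverse_eq_divide add.commute)
  qed
  then show ?thesis using assms(1) by auto
qed

definition ratios_converge :: "real^2 \<Rightarrow> (nat \<Rightarrow> int^3^3) \<Rightarrow> bool" where
  "ratios_converge x T \<longleftrightarrow> (\<exists>L M.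
     (\<lambda>n. (MAX i. dist x (vertex (T n) i))
            / (2 * real_of_int (denom (T n) 1) * real_of_int (denom (T n) 2)
                 * real_of_int (denom (T n) 3)) powr (- 1 / 2)) \<longlonglongrightarrow> L \<and>
     (\<lambda>n. longest_side (T n) / (area (T n)) powr (1 / 2)) \<longlonglongrightarrow> M \<and>
     L \<le> M \<and> M < 2 * (13 / 23) powr (1 / 4))"

text \<open>Both quotients lie between 0 and 2, so by compactness their pairs have a convergent
  subsequence. The inequality between them passes to the limit, and the bound 6 on fourth powers
  leaves enough room for strictness.\<close>

lemma exists_convergent_ratios:
  assumes "\<And>n. unimodular (T n)" "\<And>n. nearly_equilateral (1 / 100) (T n)" "\<And>n. x \<in> triangle (T n)"
  obtains r :: "nat \<Rightarrow> nat" where "strict_mono r" "ratios_converge x (\<lambda>n. T (r n))"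
proof -
  define f where "f = (\<lambda>n. (MAX i. dist x (vertex (T n) i)) / area (T n) powr (1 / 2))"
  define g where "g = (\<lambda>n. longest_side (T n) / area (T n) powr (1 / 2))"
  have area: "area (T n) powr (1 / 2) > 0" for n using area_pos[OF assms(1)[of n]] by simp
  have fg: "0 \<le> f n" "f n \<le> g n" for n
  proof -
    have "0 \<le> dist x (vertex (T n) 1)" by simp
    also have "\<dots> \<le> (MAX i. dist x (vertex (T n) i))" by (intro Max_ge) auto
    finally show "0 \<le> f n" using area[of n] by (simp add: f_def)
    have "(MAX i. dist x (vertex (T n) i)) \<le> longest_side (T n)"
      using dist_vertex_le_longest_side[OF assms(3)] by (intro Max.boundedI) auto
    then show "f n \<le> g n" using area[of n] by (simp add: f_def g_def divide_right_mono)
  qed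
  have g4: "g n ^ 4 \<le> 6" for n
    unfolding g_def using sides_ratio_power4_le[OF assms(1,2)] .
  have g2: "g n \<le> 2" for n
  proof (rule power_le_imp_le_base)
    show "g n ^ Suc 3 \<le> 2 ^ Suc 3" using g4[of n] by simp
  qed simp
  have "bounded (range (\<lambda>n. (f n, g n)))"
  proof (rule bounded_subset)
    show "bounded ({0..2::real} \<times> {0..2::real})" by (intro bounded_Times) auto
    show "range (\<lambda>n. (f n, g n)) \<subseteq> {0..2} \<times> {0..2}"
      using fg(1) g2 order_trans[OF fg] order_trans[OF fg(2) g2] by auto
  qed
  then obtain l r where r: "strict_mono r" "((\<lambda>n. (f n, g n)) \<circ> r) \<longlonglongrightarrow> l"
    using bounded_imp_convergent_subsequence by blast
  have lim: "(\<lambda>n. f (r n)) \<longlonglongrightarrow> fst l" "(\<lambda>n. g (r n)) \<longlonglongrightarrow> snd l"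
    using tendsto_fst[OF r(2)] tendsto_snd[OF r(2)] by (simp_all add: o_def)
  have "fst l \<le> snd l"
    using fg(2) by (intro LIMSEQ_le[OF lim]) auto
  moreover have "snd l < 2 * (13 / 23) powr (1 / 4)"
  proof (rule power_less_imp_less_base)
    have "snd l ^ 4 \<le> 6"
      using g4 by (intro LIMSEQ_le_const2[OF tendsto_power[OF lim(2)]]) auto
    also have "(6::real) < (2 * (13 / 23) powr (1 / 4)) ^ 4"
      by (simp add: power_mult_distrib powr_power)
    finally show "snd l ^ 4 < (2 * (13 / 23) powr (1 / 4)) ^ 4" .
  qed simp
  ultimately have "ratios_converge x (\<lambda>n. T (r n))"
    unfolding ratios_converge_def dehomogenized_area[OF assms(1)]
    using lim by (auto simp: f_def g_def)
  then show ?thesis by (rule that[OF r(1)])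
qed

lemma expansion_at_good_point:
  assumes "x \<in> good_points"
  obtains T :: "nat \<Rightarrow> int^3^3" where "\<And>n. unimodular (T n)" "(\<Inter>n. triangle (T n)) = {x}"
    "\<And>n. nearly_equilateral (1 / 100) (T n)" "ratios_converge x T"
proof -
  have "\<exists>T. small_equilateral n T \<and> x \<in> triangle T" for n
  proof -
    obtain T where "small_equilateral n T" "x \<in> interior (triangle T)"
      using assms unfolding good_points_def by blast
    then show ?thesis using interior_subset by blast
  qed
  then obtain T where T: "\<And>n. small_equilateral n (T n)" "\<And>n. x \<in> triangle (T n)" by metis
  then have unim: "\<And>n. unimodular (T n)" "\<And>n. nearly_equilateral (1 / 100) (T n)"
    and ball: "\<And>n. triangle (T n) \<subseteq> ball x (1 / (real n + 1))"
    unfolding small_equilateral_def by (auto simp: add.commute)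
  obtain r where r: "strict_mono r" "ratios_converge x (\<lambda>n. T (r n))"
    using exists_convergent_ratios[OF unim T(2)] .
  \<comment> \<open>Since \<open>r n\<close> is at least n, the subsequence shrinks at least as fast
    and still intersects in x alone.\<close>
  have "triangle (T (r n)) \<subseteq> ball x (1 / (real n + 1))" for n
  proof -
    have "1 / (real (r n) + 1) \<le> 1 / (real n + 1)"
      using seq_suble[OF r(1), of n] by (intro divide_left_mono) auto
    then show ?thesis using ball[of "r n"] subset_ball[of _ _ x] by (meson order_trans)
  qed
  then have "(\<Inter>n. triangle (T (r n))) = {x}"
    using T(2) by (intro inter_triangles_eq)
  with unim r(2) show ?thesis by (intro that[of "\<lambda>n. T (r n)"])
qed

lemma expansion_exists:
  obtains T :: "nat \<Rightarrow> int^3^3" where "\<And>n. unimodular (T n)" "(\<Inter>n. triangle (T n)) = {x}"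
proof -
  have "\<exists>T. unimodular T \<and> x \<in> triangle T \<and> triangle T \<subseteq> ball x (1 / (real n + 1))" for n
    by (rule unimodular_triangle_in_ball[of "1 / (real n + 1)" x]) auto
  then obtain T where "\<And>n. unimodular (T n)" "\<And>n. x \<in> triangle (T n)"
      "\<And>n. triangle (T n) \<subseteq> ball x (1 / (real n + 1))"
    by metis
  then show ?thesis by (intro that[of T] inter_triangles_eq)
qed

theorem corollary1p3:
  "\<exists>(\<mu> :: real^2 \<Rightarrow> nat \<Rightarrow> int^3^3) (D :: (real^2) set).
     continued_fraction_expansion \<mu> \<and>
     closure D = UNIV \<and>
     (\<forall>x\<in>D. rank3_point x) \<and>
     (\<forall>x\<in>D.
        (\<forall>n i j k. i \<noteq> j \<and> j \<noteq> k \<and> i \<noteq> k \<longrightarrow>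
           angle (vertex (\<mu> x n) i) (vertex (\<mu> x n) j) (vertex (\<mu> x n) k) > arcsin (sqrt 23 / 6)) \<and>
        (\<exists>L M.
           (\<lambda>n. (MAX i. dist x (vertex (\<mu> x n) i))
                  / (2 * real_of_int (denom (\<mu> x n) 1) * real_of_int (denom (\<mu> x n) 2)
                       * real_of_int (denom (\<mu> x n) 3)) powr (- 1 / 2)) \<longlonglongrightarrow> L \<and>
           (\<lambda>n. longest_side (\<mu> x n) / (area (\<mu> x n)) powr (1 / 2)) \<longlonglongrightarrow> M \<and>
           L \<le> M \<and>
           M < 2 * (13 / 23) powr (1 / 4)))"
proof -
  \<comment> \<open>A single choice must cover all points, so the extra properties are conditional
    on x being good; elsewhere any shrinking unimodular sequence serves.\<close>
  have "\<exists>T. (\<forall>n. unimodular (T n)) \<and> (\<Inter>n. triangle (T n)) = {x} \<and>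
      (x \<in> good_points \<longrightarrow> (\<forall>n. nearly_equilateral (1 / 100) (T n)) \<and> ratios_converge x T)" for x
  proof (cases "x \<in> good_points")
    case True
    then show ?thesis by (rule expansion_at_good_point) blast
  next
    case False
    show ?thesis by (rule expansion_exists[of x]) (use False in blast)
  qed
  then obtain \<mu> where "\<forall>x. (\<forall>n. unimodular (\<mu> x n)) \<and> (\<Inter>n. triangle (\<mu> x n)) = {x} \<and>
      (x \<in> good_points \<longrightarrow> (\<forall>n. nearly_equilateral (1 / 100) (\<mu> x n)) \<and> ratios_converge x (\<mu> x))"
    using choice[of "\<lambda>x T. (\<forall>n. unimodular (T n)) \<and> (\<Inter>n. triangle (T n)) = {x} \<and>
      (x \<in> good_points \<longrightarrow> (\<forall>n. nearly_equilateral (1 / 100) (T n)) \<and> ratios_converge x T)"] by blast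
  then have \<mu>: "\<And>x n. unimodular (\<mu> x n)" "\<And>x. (\<Inter>n. triangle (\<mu> x n)) = {x}"
      "\<And>x n. x \<in> good_points \<Longrightarrow> nearly_equilateral (1 / 100) (\<mu> x n)"
      "\<And>x. x \<in> good_points \<Longrightarrow> ratios_converge x (\<mu> x)"
    by blast+
  have "continued_fraction_expansion \<mu>"
    using \<mu>(1,2) by (simp add: continued_fraction_expansion_def)
  moreover have "rank3_point x" if "x \<in> good_points" for x
    using that by (intro rank3_pointI) (auto simp: good_points_def)
  moreover have "angle (vertex (\<mu> x n) i) (vertex (\<mu> x n) j) (vertex (\<mu> x n) k) > arcsin (sqrt 23 / 6)"
    if "x \<in> good_points" "i \<noteq> j" "j \<noteq> k" "i \<noteq> k" for x n i j k
  proof -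
    have "nearly_equilateral (1 / 100) (\<mu> x n)" using \<mu>(3) that(1) .
    then obtain a where "a > 0"
      "\<And>i j. i \<noteq> j \<Longrightarrow> \<bar>(dist (vertex (\<mu> x n) i) (vertex (\<mu> x n) j))\<^sup>2 - a\<bar> \<le> 1 / 100 * a"
      unfolding nearly_equilateral_def by blast
    with that(2-4) show ?thesis
      by (intro angle_gt_of_nearly_equal_sides[of a]) auto
  qed
  ultimately show ?thesis
    using closure_good_points \<mu>(4)[unfolded ratios_converge_def]
    by (intro exI[of _ \<mu>] exI[of _ good_points] conjI ballI allI impI) auto
qed

end
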